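(* Let $F$ be the free group of rank two with free basis $A,B$, and let $E_{p/q}\in F$, for $p/q\in\mathbb{Q}\cup\{1/0\}$, be the words defined by the enumeration scheme in the context. If $p/q$ and $p'/q'$ in $\mathbb{Q}\cup\{1/0\}$ satisfy $|pq'-qp'|=1$, then the pair $(E_{p/q},E_{p'/q'})$ generates $F$.
   Context: Rationals $p/q$ are written in lowest terms with $q>0$; $1/0$ denotes the point at infinity, regarded as larger than every nonnegative rational in the positive scheme below and (as $-\infty$) as smaller than every nonpositive rational in the negative scheme. Parents. Let $p/q>0$ have continued fraction expansion $[a_0;a_1,\dots,a_k]=a_0+\cfrac{1}{a_1+\cfrac{1}{\ddots+\cfrac{1}{a_k}}}$ with integers $a_0\ge 0$, $a_j>0$ for $1\le j\le k$, and $a_k\ge 2$ if $k\ge1$. The parents of $p/q$ are the two fractions $[a_0;a_1,\dots,a_{k-1}]$ and $[a_0;a_1,\dots,a_{k-1},a_k-1]$, where for $k=0$ the first (empty) expansion is understood as $1/0$ and the second is $(a_0-1)/1$. One parent is smaller than $p/q$ and the other is larger. (They are the two Farey neighbors of $p/q$ whose Farey sum is $p/q$: if $m/n<p/q<r/s$ are the parents, then $p=m+r$, $q=n+s$, and $|ms-nr|=1$.) For $p/q<0$ the parents of $p/q$ are the negatives of the parents of $|p/q|$, with $-1/0$ identified with $1/0$. Enumeration scheme for positive rationals (words $E^{+}_{p/q}$, $p/q\in\mathbb{Q}_{\ge0}\cup\{1/0\}$). Set $E^{+}_{0/1}=A^{-1}$, $E^{+}_{1/0}=B$, $E^{+}_{1/1}=BA^{-1}$.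 Inductively, for $p/q>0$ with parents $m/n<p/q<r/s$, set $E^{+}_{p/q}=E^{+}_{r/s}E^{+}_{m/n}$ if $pq$ is odd, and $E^{+}_{p/q}=E^{+}_{m/n}E^{+}_{r/s}$ if $pq$ is even. Enumeration scheme for negative rationals (words $E^{-}_{p/q}$, $p/q\in\mathbb{Q}_{\le0}\cup\{1/0\}$). Set $E^{-}_{0/1}=A$, $E^{-}_{1/0}=B$, $E^{-}_{-1/1}=BA$. Inductively, for $p/q<0$ with parents $m/n>p/q>r/s$, set $E^{-}_{p/q}=E^{-}_{r/s}E^{-}_{m/n}$ if $pq$ is odd, and $E^{-}_{p/q}=E^{-}_{m/n}E^{-}_{r/s}$ if $pq$ is even. Define $E_{p/q}=E^{+}_{p/q}$ for $p/q\in\mathbb{Q}_{\ge0}\cup\{1/0\}$ and $E_{p/q}=E^{-}_{p/q}$ for $p/q<0$ (the two schemes agree at $1/0$, and at $0/1$ up to inversion). *)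

theory Defs
  imports Complex_Main "HOL-Algebra.Generated_Groups"
begin

section \<open>Free bases\<close>

text \<open>A word over \<open>S\<close> is a list of letters \<open>(x, e)\<close> with \<open>x \<in> S\<close>, standing for \<open>x\<close> if
  \<open>e\<close> is true and for the inverse of \<open>x\<close> otherwise.\<close>

definition word_val :: "('a, 'b) monoid_scheme \<Rightarrow> ('a \<times> bool) list \<Rightarrow> 'a" where
  "word_val G w =
     foldr (\<lambda>(x, e) g. (if e then x else inv\<^bsub>G\<^esub> x) \<otimes>\<^bsub>G\<^esub> g) w \<one>\<^bsub>G\<^esub>"

definition reduced :: "('a \<times> bool) list \<Rightarrow> bool" where
  "reduced w \<longleftrightarrow>
     (\<forall>i. Suc i < length w \<longrightarrow> \<not> (fst (w ! i) = fst (w ! Suc i) \<and> snd (w ! i) \<noteq> snd (w ! Suc i)))"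

definition free_basis :: "('a, 'b) monoid_scheme \<Rightarrow> 'a set \<Rightarrow> bool" where
  "free_basis G S \<longleftrightarrow>
     S \<subseteq> carrier G \<and> bij_betw (word_val G) {w \<in> lists (S \<times> UNIV). reduced w} (carrier G)"


section \<open>Rationals and the point at infinity\<close>

text \<open>\<open>Inf\<close> is the fraction \<open>1/0\<close>.\<close>

datatype xrat = Fin rat | Inf

fun xnum :: "xrat \<Rightarrow> int" where
  "xnum (Fin x) = fst (quotient_of x)"
| "xnum Inf = 1"

fun xden :: "xrat \<Rightarrow> int" where
  "xden (Fin x) = snd (quotient_of x)"
| "xden Inf = 0"

fun xneg :: "xrat \<Rightarrow> xrat" where
  "xneg (Fin x) = Fin (- x)"
| "xneg Inf = Inf"

text \<open>\<open>1/0\<close> is the largest element in the positive scheme and the smallest one in the negative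
  scheme.\<close>

fun less_pos :: "xrat \<Rightarrow> xrat \<Rightarrow> bool" where
  "less_pos (Fin x) (Fin y) \<longleftrightarrow> x < y"
| "less_pos (Fin x) Inf \<longleftrightarrow> True"
| "less_pos Inf v \<longleftrightarrow> False"

fun less_neg :: "xrat \<Rightarrow> xrat \<Rightarrow> bool" where
  "less_neg (Fin x) (Fin y) \<longleftrightarrow> x < y"
| "less_neg Inf (Fin y) \<longleftrightarrow> True"
| "less_neg u Inf \<longleftrightarrow> False"


section \<open>Continued fractions and parents\<close>

text \<open>The empty continued fraction is \<open>1/0\<close>, and \<open>1/(1/0)\<close> is \<open>0\<close>, so that \<open>[a]\<close> has value \<open>a\<close>.\<close>

fun cf_val :: "nat list \<Rightarrow> xrat" where
  "cf_val [] = Inf"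
| "cf_val (a # as) = Fin (of_nat a + (case cf_val as of Fin y \<Rightarrow> 1 / y | Inf \<Rightarrow> 0))"

definition normal_cf :: "nat list \<Rightarrow> bool" where
  "normal_cf as \<longleftrightarrow> as \<noteq> [] \<and> (\<forall>a \<in> set (tl as). a > 0) \<and> (length as \<ge> 2 \<longrightarrow> last as \<ge> 2)"

definition cf :: "rat \<Rightarrow> nat list" where
  "cf x = (THE as. normal_cf as \<and> cf_val as = Fin x)"

definition parents_pos :: "rat \<Rightarrow> xrat \<times> xrat" where
  "parents_pos x =
     (let as = cf x in (cf_val (butlast as), cf_val (butlast as @ [last as - 1])))"

definition parents :: "rat \<Rightarrow> xrat \<times> xrat" where
  "parents x =
     (if x > 0 then parents_pos x
      else (xneg (fst (parents_pos \<bar>x\<bar>)), xneg (snd (parents_pos \<bar>x\<bar>))))"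

subsection \<open>Existence and uniqueness of normal continued fractions\<close>

lemma cf_val_gt_1:
  assumes "as \<noteq> []" "\<forall>a \<in> set as. a > 0" "last as \<ge> 2"
  shows "\<exists>y. cf_val as = Fin y \<and> y > 1"
  using assms
proof (induction as)
  case (Cons a as)
  show ?case
  proof (cases "as = []")
    case False
    then obtain y where y: "cf_val as = Fin y" "y > 1" using Cons by auto
    have "(of_nat a :: rat) \<ge> 1" using Cons.prems by simp
    moreover have "1 / y > 0" using y by simp
    ultimately have "of_nat a + 1 / y > 1" by linarith
    then show ?thesis using y by simp
  qed (use Cons.prems in simp)
qed simp

lemma normal_cf_Cons:
  "normal_cf (a # as) \<longleftrightarrow> as = [] \<or> (normal_cf as \<and> (\<forall>a \<in> set as. a > 0) \<and> last as \<ge> 2)"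
  by (cases as) (auto simp: normal_cf_def Suc_le_eq)

lemma normal_cf_tail:
  assumes "normal_cf (a # as)" "as \<noteq> []"
  obtains y where "cf_val as = Fin y" "y > 1"
  using assms cf_val_gt_1[of as] normal_cf_Cons by blast

lemma normal_cf_floor:
  assumes "normal_cf (a # as)" "cf_val (a # as) = Fin x"
  shows "\<lfloor>x\<rfloor> = int a"
proof (cases "as = []")
  case False
  obtain y where y: "cf_val as = Fin y" "y > 1" using normal_cf_tail[OF assms(1) False] .
  have "0 < 1 / y" "1 / y < 1" using y by auto
  then show ?thesis using assms(2) y by (auto intro!: floor_unique)
qed (use assms in auto)

lemma normal_cf_unique:
  assumes "normal_cf as" "normal_cf bs" "cf_val as = cf_val bs"
  shows "as = bs"
  using assms
proof (induction as arbitrary: bs)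
  case (Cons a as)
  obtain b bs' where bs: "bs = b # bs'" using Cons.prems(2) by (cases bs) (auto simp: normal_cf_def)
  have ab: "a = b"
    using normal_cf_floor[OF Cons.prems(1)] normal_cf_floor[of b bs'] Cons.prems bs
    by (metis cf_val.simps(2) int_int_eq)
  then have eq: "(case cf_val as of Fin y \<Rightarrow> 1 / y | Inf \<Rightarrow> 0) = (case cf_val bs' of Fin y \<Rightarrow> 1 / y | Inf \<Rightarrow> 0)"
    using Cons.prems(3) bs by simp
  show ?case
  proof (cases "as = []")
    case True
    have "bs' = []"
    proof (rule ccontr)
      assume "bs' \<noteq> []"
      then obtain y where "cf_val bs' = Fin y" "y > 1"
        using normal_cf_tail[of b bs'] Cons.prems(2) bs by blast
      then show False using eq True by auto
    qed
    then show ?thesis using ab bs True by simp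
  next
    case False
    obtain y where y: "cf_val as = Fin y" "y > 1" using normal_cf_tail[OF Cons.prems(1) False] .
    have ne: "bs' \<noteq> []" using eq y by auto
    then obtain z where z: "cf_val bs' = Fin z" "z > 1"
      using normal_cf_tail[of b bs'] Cons.prems(2) bs by blast
    have "cf_val as = cf_val bs'" using eq y z by simp
    then have "as = bs'"
      using Cons.IH Cons.prems bs False ne by (auto simp: normal_cf_Cons)
    then show ?thesis using ab bs by simp
  qed
qed (auto simp: normal_cf_def)

lemma normal_cf_exists_nat:
  assumes "q > 0"
  shows "\<exists>as. normal_cf as \<and> cf_val as = Fin (of_nat p / of_nat q)"
  using assms
proof (induction q arbitrary: p rule: less_induct)
  case (less q)
  have "(of_nat p :: rat) = of_nat (p div q) * of_nat q + of_nat (p mod q)"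
    by (simp only: of_nat_mult[symmetric] of_nat_add[symmetric] div_mult_mod_eq)
  moreover have "(of_nat q :: rat) \<noteq> 0" using less.prems by simp
  ultimately have split: "(of_nat p :: rat) / of_nat q = of_nat (p div q) + of_nat (p mod q) / of_nat q"
    by (metis add_divide_distrib nonzero_mult_div_cancel_right)
  show ?case
  proof (cases "p mod q = 0")
    case True
    then show ?thesis using split by (intro exI[of _ "[p div q]"]) (auto simp: normal_cf_def)
  next
    case False
    then obtain as where as: "normal_cf as" "cf_val as = Fin (of_nat q / of_nat (p mod q))"
      using less.IH[of "p mod q" q] less.prems by auto
    obtain b bs where bs: "as = b # bs" using as by (cases as) (auto simp: normal_cf_def)
    have gt: "(of_nat q / of_nat (p mod q) :: rat) > 1" using False less.prems by simp
    have "int b = \<lfloor>(of_nat q / of_nat (p mod q) :: rat)\<rfloor>" using normal_cf_floor as bs by metis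
    moreover have "1 \<le> \<lfloor>(of_nat q / of_nat (p mod q) :: rat)\<rfloor>"
      using gt by (simp add: le_floor_iff)
    ultimately have "b > 0" by linarith
    moreover have "b \<ge> 2" if "bs = []"
    proof -
      have "(of_nat b :: rat) > 1" using as(2) bs that gt by simp
      then show ?thesis by simp
    qed
    ultimately have "normal_cf ((p div q) # as)" using as(1) bs by (auto simp: normal_cf_def Suc_le_eq)
    moreover have "cf_val ((p div q) # as) = Fin (of_nat p / of_nat q)" using as(2) split by simp
    ultimately show ?thesis by blast
  qed
qed

lemma normal_cf_exists:
  assumes "x \<ge> 0"
  shows "\<exists>as. normal_cf as \<and> cf_val as = Fin x"
proof -
  obtain p q where pq: "quotient_of x = (p, q)" by force
  have x: "x = of_int p / of_int q" and q: "q > 0"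
    using quotient_of_div[OF pq] quotient_of_denom_pos[OF pq] by simp_all
  have "p \<ge> 0" using assms q unfolding x by (simp add: zero_le_divide_iff)
  then have "x = of_nat (nat p) / of_nat (nat q)" using x q by simp
  moreover have "nat q > 0" using q by simp
  ultimately show ?thesis using normal_cf_exists_nat[of "nat q" "nat p"] by simp
qed

lemma cf_correct:
  assumes "x \<ge> 0"
  shows "normal_cf (cf x) \<and> cf_val (cf x) = Fin x"
proof -
  have "\<exists>!as. normal_cf as \<and> cf_val as = Fin x"
    using normal_cf_exists[OF assms] normal_cf_unique by (metis (no_types))
  then show ?thesis unfolding cf_def by (rule theI')
qed

subsection \<open>The Farey sum of the parents\<close>

fun cf_map :: "nat list \<Rightarrow> nat \<times> nat \<Rightarrow> nat \<times> nat" where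
  "cf_map [] v = v"
| "cf_map (a # as) v = (a * fst (cf_map as v) + snd (cf_map as v), fst (cf_map as v))"

lemma cf_map_append: "cf_map (as @ bs) v = cf_map as (cf_map bs v)"
  by (induction as) auto

lemma cf_map_add:
  "cf_map as (p + p', q + q') =
     (fst (cf_map as (p, q)) + fst (cf_map as (p', q')), snd (cf_map as (p, q)) + snd (cf_map as (p', q')))"
  by (induction as) (auto simp: algebra_simps)

lemma cf_map_last:
  assumes "a > 0"
  shows "fst (cf_map (as @ [a]) (1, 0)) = fst (cf_map as (1, 0)) + fst (cf_map (as @ [a - 1]) (1, 0))"
    and "snd (cf_map (as @ [a]) (1, 0)) = snd (cf_map as (1, 0)) + snd (cf_map (as @ [a - 1]) (1, 0))"
proof -
  have "cf_map as (a, 1) = cf_map as (1 + (a - 1), 0 + 1)" using assms by simp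
  then show "fst (cf_map (as @ [a]) (1, 0)) = fst (cf_map as (1, 0)) + fst (cf_map (as @ [a - 1]) (1, 0))"
    and "snd (cf_map (as @ [a]) (1, 0)) = snd (cf_map as (1, 0)) + snd (cf_map (as @ [a - 1]) (1, 0))"
    unfolding cf_map_append cf_map_add by auto
qed

lemma coprime_cf_map: "coprime (fst (cf_map as (1, 0))) (snd (cf_map as (1, 0)))"
proof (induction as)
  case (Cons a as)
  then show ?case by (simp add: coprime_iff_gcd_eq_1 gcd.commute gcd_add_mult)
qed simp

lemma cf_map_pos: "\<forall>a \<in> set as. a > 0 \<Longrightarrow> fst (cf_map as (1, 0)) > 0"
  by (induction as) auto

definition frac_of :: "nat \<times> nat \<Rightarrow> xrat" where
  "frac_of v = (if snd v = 0 then Inf else Fin (of_nat (fst v) / of_nat (snd v)))"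

lemma cf_val_eq:
  assumes "\<forall>a \<in> set (tl as). a > 0"
  shows "cf_val as = frac_of (cf_map as (1, 0))"
  using assms
proof (induction as)
  case (Cons a as)
  define v where "v = cf_map as (1, 0)"
  have pos: "fst v > 0" using cf_map_pos Cons.prems v_def by simp
  have IH: "cf_val as = frac_of v"
    using Cons v_def by (metis list.sel(2) list.sel(3) list.set_sel(2))
  show ?case
    using pos unfolding cf_val.simps cf_map.simps IH v_def[symmetric]
    by (auto simp: frac_of_def field_simps)
qed (simp add: frac_of_def)

lemma frac_of_num_den:
  assumes "coprime (fst v) (snd v)"
  shows "xnum (frac_of v) = int (fst v)" "xden (frac_of v) = int (snd v)"
proof -
  have "quotient_of (of_nat (fst v) / of_nat (snd v)) = (int (fst v), int (snd v))" if "snd v \<noteq> 0"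
  proof -
    have "quotient_of (of_int (int (fst v)) / of_int (int (snd v))) = (int (fst v), int (snd v))"
      using that assms quotient_of_Fract[of "int (fst v)" "int (snd v)"]
      by (simp only: Fract_of_int_quotient[symmetric])
        (simp add: Rat.normalize_def Let_def)
    then show ?thesis by simp
  qed
  then show "xnum (frac_of v) = int (fst v)" "xden (frac_of v) = int (snd v)"
    using assms by (auto simp: frac_of_def)
qed

lemma cf_val_num_den:
  assumes "\<forall>a \<in> set (tl as). a > 0"
  shows "xnum (cf_val as) = int (fst (cf_map as (1, 0)))" "xden (cf_val as) = int (snd (cf_map as (1, 0)))"
  using frac_of_num_den[OF coprime_cf_map] cf_val_eq[OF assms] by auto

lemma parents_pos_farey:
  assumes "x > 0" "parents_pos x = (u, v)"
  shows "xnum (Fin x) = xnum u + xnum v" "xden (Fin x) = xden u + xden v"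
    "xnum u \<ge> 0" "xden u \<ge> 0" "xnum v \<ge> 0" "xden v \<ge> 0"
    "xnum u + xden u > 0" "xnum v + xden v > 0"
proof -
  define as where "as = butlast (cf x)"
  define a where "a = last (cf x)"
  have ncf: "normal_cf (cf x)" and val: "cf_val (cf x) = Fin x" using cf_correct assms(1) by auto
  have cfx: "cf x = as @ [a]" using ncf unfolding as_def a_def normal_cf_def by simp
  have pos1: "\<forall>a \<in> set (tl (as @ [a])). a > 0" using ncf cfx unfolding normal_cf_def by simp
  then have pos2: "\<forall>a \<in> set (tl as). a > 0" by (cases as) auto
  have a: "a > 0"
  proof (cases as)
    case Nil
    then show ?thesis using val cfx assms(1) by auto
  qed (use pos1 in auto)
  have pos3: "\<forall>b \<in> set (tl (as @ [a - 1])). b > 0"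
  proof (cases as)
    case (Cons b bs)
    then have "a \<ge> 2" using ncf cfx unfolding normal_cf_def by simp
    then show ?thesis using Cons pos2 by auto
  qed simp
  have uv: "u = cf_val as" "v = cf_val (as @ [a - 1])"
    using assms(2) unfolding parents_pos_def Let_def as_def a_def by auto
  note nd = cf_val_num_den[OF pos1] cf_val_num_den[OF pos2] cf_val_num_den[OF pos3]
  show "xnum (Fin x) = xnum u + xnum v" "xden (Fin x) = xden u + xden v"
    unfolding uv val[symmetric] cfx nd using cf_map_last[OF a, of as] by auto
  show "xnum u \<ge> 0" "xden u \<ge> 0" "xnum v \<ge> 0" "xden v \<ge> 0"
    unfolding uv nd by auto
  have "fst (cf_map bs (1, 0)) + snd (cf_map bs (1, 0)) > 0" for bs
    using coprime_cf_map[of bs] by (auto simp del: add_is_0 intro!: gr0I)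
  from this[of as] this[of "as @ [a - 1]"]
  show "xnum u + xden u > 0" "xnum v + xden v > 0"
    unfolding uv nd by auto
qed

lemma cf_map_det:
  "\<bar>int (fst (cf_map as (p, q))) * int (snd (cf_map as (p', q'))) -
    int (snd (cf_map as (p, q))) * int (fst (cf_map as (p', q')))\<bar> = \<bar>int p * int q' - int q * int p'\<bar>"
proof (induction as)
  case (Cons a as)
  have "int (fst (cf_map (a # as) (p, q))) * int (snd (cf_map (a # as) (p', q'))) -
    int (snd (cf_map (a # as) (p, q))) * int (fst (cf_map (a # as) (p', q'))) =
    - (int (fst (cf_map as (p, q))) * int (snd (cf_map as (p', q'))) -
    int (snd (cf_map as (p, q))) * int (fst (cf_map as (p', q'))))"
    by (simp add: algebra_simps)
  then show ?case using Cons by (simp only: abs_minus_cancel)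
qed simp

lemma less_pos_iff:
  assumes "xnum u + xden u > 0" "xnum u \<ge> 0"
  shows "less_pos u v \<longleftrightarrow> xnum u * xden v < xnum v * xden u"
proof -
  have "\<not> snd (quotient_of y) < 0" for y using quotient_of_denom_pos'[of y] by linarith
  then show ?thesis
    using assms
    by (cases u; cases v)
      (auto simp: rat_less_code split_beta quotient_of_denom_pos' mult.commute)
qed

lemma parents_pos_det:
  assumes "x > 0" "parents_pos x = (u, v)"
  shows "\<bar>xnum u * xden v - xden u * xnum v\<bar> = 1"
proof -
  define as where "as = butlast (cf x)"
  define a where "a = last (cf x)"
  have ncf: "normal_cf (cf x)" and val: "cf_val (cf x) = Fin x" using cf_correct assms(1) by auto
  have cfx: "cf x = as @ [a]" using ncf unfolding as_def a_def normal_cf_def by simp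
  have pos1: "\<forall>a \<in> set (tl (as @ [a])). a > 0" using ncf cfx unfolding normal_cf_def by simp
  then have pos2: "\<forall>a \<in> set (tl as). a > 0" by (cases as) auto
  have pos3: "\<forall>b \<in> set (tl (as @ [a - 1])). b > 0"
  proof (cases as)
    case (Cons b bs)
    then have "a \<ge> 2" using ncf cfx unfolding normal_cf_def by simp
    then show ?thesis using Cons pos2 by auto
  qed simp
  have uv: "u = cf_val as" "v = cf_val (as @ [a - 1])"
    using assms(2) unfolding parents_pos_def Let_def as_def a_def by auto
  show ?thesis
    unfolding uv cf_val_num_den[OF pos2] cf_val_num_den[OF pos3] cf_map_append
    using cf_map_det[of as 1 0 "a - 1" 1] by simp
qed

lemma quotient_of_uminus: "quotient_of (- x) = (- fst (quotient_of x), snd (quotient_of x))"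
  unfolding rat_uminus_code by (cases "quotient_of x") simp

definition xsize :: "xrat \<Rightarrow> nat" where
  "xsize u = nat (\<bar>xnum u\<bar> + xden u)"

lemma xsize_xneg: "xsize (xneg u) = xsize u"
  by (cases u) (auto simp: xsize_def quotient_of_uminus)

lemma xsize_parents_pos:
  assumes "x > 0"
  shows "xsize (fst (parents_pos x)) < xsize (Fin x)" "xsize (snd (parents_pos x)) < xsize (Fin x)"
  using parents_pos_farey[OF assms, of "fst (parents_pos x)" "snd (parents_pos x)"]
  by (auto simp: xsize_def)

lemma xsize_parents:
  assumes "x \<noteq> 0"
  shows "xsize (fst (parents x)) < xsize (Fin x)" "xsize (snd (parents x)) < xsize (Fin x)"
  using assms xsize_parents_pos[of x] xsize_parents_pos[of "- x"] xsize_xneg[of "Fin x"]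
  by (auto simp: parents_def xsize_xneg)


section \<open>The enumeration schemes\<close>

text \<open>Of the two parents of \<open>x\<close> exactly one is smaller than \<open>x\<close>; comparing the first parent
  with \<open>x\<close> therefore puts the pair in order. The functions below return the parents
  \<open>m/n < x < r/s\<close> of \<open>x > 0\<close>, and the parents \<open>m/n > x > r/s\<close> of \<open>x < 0\<close>, as \<open>(m/n, r/s)\<close>.\<close>

definition increasing_parents :: "rat \<Rightarrow> xrat \<times> xrat" where
  "increasing_parents x =
     (let (u, v) = parents x in if less_pos u (Fin x) then (u, v) else (v, u))"

definition decreasing_parents :: "rat \<Rightarrow> xrat \<times> xrat" where
  "decreasing_parents x =
     (let (u, v) = parents x in if less_neg (Fin x) u then (u, v) else (v, u))"

lemma xsize_ordered_parents:
  assumes "x \<noteq> 0"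
  shows "increasing_parents x = (m, r) \<Longrightarrow> xsize m < xsize (Fin x) \<and> xsize r < xsize (Fin x)"
    and "decreasing_parents x = (m, r) \<Longrightarrow> xsize m < xsize (Fin x) \<and> xsize r < xsize (Fin x)"
  using xsize_parents[OF assms]
  by (auto simp: increasing_parents_def decreasing_parents_def split: prod.splits if_splits)

lemma increasing_parents_less:
  assumes "x > 0" "increasing_parents x = (m, r)"
  shows "less_pos m (Fin x) \<and> less_pos (Fin x) r"
proof -
  obtain u v where uv: "parents_pos x = (u, v)" by force
  note f = parents_pos_farey[OF assms(1) uv] and d = parents_pos_det[OF assms(1) uv]
  have x: "xnum (Fin x) + xden (Fin x) > 0" "xnum (Fin x) \<ge> 0" using f by linarith+
  have iff: "less_pos u (Fin x) \<longleftrightarrow> xnum u * xden v < xden u * xnum v"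
     "less_pos v (Fin x) \<longleftrightarrow> xnum u * xden v > xden u * xnum v"
     "less_pos (Fin x) u \<longleftrightarrow> xnum u * xden v > xden u * xnum v"
     "less_pos (Fin x) v \<longleftrightarrow> xnum u * xden v < xden u * xnum v"
    using less_pos_iff[OF f(7) f(3), of "Fin x"] less_pos_iff[OF f(8) f(5), of "Fin x"]
      less_pos_iff[OF x, of u] less_pos_iff[OF x, of v] unfolding f(1,2)
    by (simp_all add: algebra_simps)
  show ?thesis using assms uv d iff by (auto simp: increasing_parents_def parents_def split: if_splits)
qed

lemma less_neg_xneg: "less_neg (Fin x) (xneg u) \<longleftrightarrow> less_pos u (Fin (-x))"
  "less_neg (xneg u) (Fin x) \<longleftrightarrow> less_pos (Fin (-x)) u"
  by (cases u; auto)+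

lemma decreasing_parents_less:
  assumes "x < 0" "decreasing_parents x = (m, r)"
  shows "less_neg (Fin x) m \<and> less_neg r (Fin x)"
proof -
  obtain m' r' where mr: "increasing_parents (-x) = (m', r')" by force
  have "m = xneg m' \<and> r = xneg r'" using mr assms 
   by (auto simp: increasing_parents_def decreasing_parents_def parents_def less_neg_xneg split: prod.splits if_splits)
  then show ?thesis using increasing_parents_less[OF _ mr] assms by (auto simp: less_neg_xneg)
qed

text \<open>The positive scheme is only meaningful on nonnegative rationals and \<open>1/0\<close>, the negative
  scheme on nonpositive rationals and \<open>1/0\<close>.\<close>

function E_pos :: "('a, 'b) monoid_scheme \<Rightarrow> 'a \<Rightarrow> 'a \<Rightarrow> xrat \<Rightarrow> 'a" where
  "E_pos G A B Inf = B"
| "E_pos G A B (Fin x) =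
     (if x < 0 then undefined
      else if x = 0 then inv\<^bsub>G\<^esub> A
      else if x = 1 then B \<otimes>\<^bsub>G\<^esub> inv\<^bsub>G\<^esub> A
      else (case increasing_parents x of (m, r) \<Rightarrow>
        if odd (xnum (Fin x) * xden (Fin x))
        then E_pos G A B r \<otimes>\<^bsub>G\<^esub> E_pos G A B m
        else E_pos G A B m \<otimes>\<^bsub>G\<^esub> E_pos G A B r))"
  by pat_completeness auto
termination
  by (relation "measure (\<lambda>(G, A, B, u). xsize u)")
    (auto dest: xsize_ordered_parents(1)[OF _ sym] xsize_ordered_parents(2)[OF _ sym])

function E_neg :: "('a, 'b) monoid_scheme \<Rightarrow> 'a \<Rightarrow> 'a \<Rightarrow> xrat \<Rightarrow> 'a" where
  "E_neg G A B Inf = B"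
| "E_neg G A B (Fin x) =
     (if x > 0 then undefined
      else if x = 0 then A
      else if x = -1 then B \<otimes>\<^bsub>G\<^esub> A
      else (case decreasing_parents x of (m, r) \<Rightarrow>
        if odd (xnum (Fin x) * xden (Fin x))
        then E_neg G A B r \<otimes>\<^bsub>G\<^esub> E_neg G A B m
        else E_neg G A B m \<otimes>\<^bsub>G\<^esub> E_neg G A B r))"
  by pat_completeness auto
termination
  by (relation "measure (\<lambda>(G, A, B, u). xsize u)")
    (auto dest: xsize_ordered_parents(1)[OF _ sym] xsize_ordered_parents(2)[OF _ sym])

definition E :: "('a, 'b) monoid_scheme \<Rightarrow> 'a \<Rightarrow> 'a \<Rightarrow> xrat \<Rightarrow> 'a" where
  "E G A B u =
     (case u of Inf \<Rightarrow> E_pos G A B u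
      | Fin x \<Rightarrow> if x \<ge> 0 then E_pos G A B u else E_neg G A B u)"

end

theory Submission
  imports Defs
begin

text \<open>Unless two Farey neighbours in \<open>[0, \<infinity>]\<close> are \<open>0\<close> and \<open>1/0\<close>, the one with the larger sum of
  numerator and denominator has the other one as a parent, and its word is the product, in some
  order, of the words of its two parents. Replacing it by its second parent therefore does not
  change the subgroup generated by the pair, and the descent ends at the pair \<open>0\<close>, \<open>1/0\<close>. The
  negative scheme is the positive scheme for the basis \<open>A\<inverse>, B\<close>, and two finite neighbours are
  never strictly separated by \<open>0\<close>.\<close>

section \<open>Subgroups generated by pairs, and by a free basis\<close>

context group
begin

lemma generate_pair_eqI:
  assumes "a \<in> carrier G" "b \<in> carrier G" "c \<in> generate G {a, b}" "d \<in> generate G {a, b}"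
    and "a \<in> generate G {c, d}" "b \<in> generate G {c, d}"
  shows "generate G {a, b} = generate G {c, d}"
proof
  have sub: "subgroup (generate G {a, b}) G"
    using assms by (intro generate_is_subgroup) auto
  then have cd: "{c, d} \<subseteq> carrier G"
    using assms(3,4) subgroup.subset by blast
  show "generate G {c, d} \<subseteq> generate G {a, b}"
    by (rule generate_subgroup_incl[OF _ sub]) (use assms in auto)
  show "generate G {a, b} \<subseteq> generate G {c, d}"
    by (rule generate_subgroup_incl[OF _ generate_is_subgroup[OF cd]]) (use assms in auto)
qed

lemma generate_pair_mult:
  assumes "a \<in> carrier G" "b \<in> carrier G" "c = a \<otimes> b \<or> c = b \<otimes> a"
  shows "generate G {a, c} = generate G {a, b}"
proof -
  have incl: "x \<in> generate G {x, y}" "y \<in> generate G {x, y}"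
    "inv x \<in> generate G {x, y}" for x y
    by (auto intro: generate.intros)
  have "c \<in> generate G {a, b}"
    using assms(3) by (auto intro: generate.intros)
  moreover have "b = inv a \<otimes> c \<or> b = c \<otimes> inv a"
    using assms by (auto simp: m_assoc inv_solve_left inv_solve_right)
  then have "b \<in> generate G {a, c}"
    using incl(2)[of c a] incl(3)[of a c] generate.eng[of _ G "{a, c}"] by metis
  ultimately show ?thesis
    using generate_pair_eqI[of a b a c] assms(1,2) incl by metis
qed

lemma generate_pair_inv:
  assumes "a \<in> carrier G" "b \<in> carrier G"
  shows "generate G {inv a, b} = generate G {a, b}"
proof (rule generate_pair_eqI[symmetric])
  have "inv (inv a) \<in> generate G {inv a, b}" by (rule generate.inv) simp
  then show "a \<in> generate G {inv a, b}" using assms by simp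
qed (use assms in \<open>auto intro: generate.intros\<close>)

text \<open>Every element is the value of a word over \<open>S\<close>, and such a value is a
  product of generators and their inverses.\<close>

lemma generate_free_basis:
  assumes "free_basis G S"
  shows "generate G S = carrier G"
proof
  have S: "S \<subseteq> carrier G"
    and img: "word_val G ` {w \<in> lists (S \<times> UNIV). reduced w} = carrier G"
    using assms by (auto simp: free_basis_def bij_betw_def)
  show "generate G S \<subseteq> carrier G" using generate_incl[OF S] .
  have "word_val G w \<in> generate G S" if "w \<in> lists (S \<times> UNIV)" for w
    using that
  proof (induction w)
    case (Cons l w)
    obtain x e where l: "l = (x, e)" "x \<in> S" using Cons.hyps(1) by auto
    have "(if e then x else inv x) \<in> generate G S"
      using l(2) by (simp add: generate.incl generate.inv)
    from generate.eng[OF this Cons.IH] show ?case by (simp add: word_val_def l(1))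
  qed (simp add: word_val_def generate.one)
  then show "carrier G \<subseteq> generate G S" unfolding img[symmetric] by (intro image_subsetI) simp
qed

end

section \<open>Numerators and denominators of points of the extended line\<close>

lemma xden_nonneg: "xden u \<ge> 0"
  by (cases u) (simp_all add: quotient_of_denom_pos' less_imp_le)

lemma xnum_Fin_nonneg_iff: "xnum (Fin x) \<ge> 0 \<longleftrightarrow> x \<ge> 0"
proof -
  have x: "x = of_int (xnum (Fin x)) / of_int (xden (Fin x))"
    using quotient_of_div[of x] by (simp add: prod_eq_iff)
  have "xden (Fin x) > 0" by (simp add: quotient_of_denom_pos')
  then show ?thesis by (subst (2) x) (simp add: zero_le_divide_iff)
qed

text \<open>From here on \<open>xnum u \<ge> 0\<close> encodes membership in the domain of the
  positive scheme, \<open>Inf\<close> included. The cases separate its two initial points from the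
  points that have parents in it.\<close>

lemma xnum_nonneg_cases:
  assumes "xnum u \<ge> 0"
  obtains "u = Inf" | "u = Fin 0" | x where "u = Fin x" "x > 0"
proof (cases u)
  case (Fin x)
  then have "x \<ge> 0" using assms xnum_Fin_nonneg_iff by blast
  then show ?thesis using that Fin by (cases "x = 0") auto
qed (use that in auto)

lemma xrat_eqI:
  assumes "xnum u = xnum v" "xden u = xden v"
  shows "u = v"
proof -
  have "snd (quotient_of x) \<noteq> 0" for x
    using quotient_of_denom_pos'[of x] by linarith
  then show ?thesis
    using assms by (cases u; cases v) (auto simp: prod_eq_iff quotient_of_inject_eq[symmetric] dest: sym)
qed

section \<open>Farey neighbours and parents\<close>

lemma parents_pos_one: "parents_pos 1 = (Inf, Fin 0)"
proof -
  have "cf 1 = [1]"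
    using cf_correct[of 1] by (intro normal_cf_unique) (auto simp: normal_cf_def)
  then show ?thesis by (simp add: parents_pos_def)
qed

text \<open>In the basis of the two parents \<open>(c, d)\<close>, \<open>(e, f)\<close>, a neighbour \<open>(a, b)\<close> of their sum has
  coordinates \<open>s\<close>, \<open>t\<close> with \<open>\<bar>s - t\<bar> = 1\<close>.\<close>

lemma farey_neighbour_is_parent:
  fixes a b c d e f :: int
  assumes "\<bar>c * f - d * e\<bar> = 1" "\<bar>a * (d + f) - b * (c + e)\<bar> = 1"
    and "a \<ge> 0" "b \<ge> 0" "c \<ge> 0" "d \<ge> 0" "e \<ge> 0" "f \<ge> 0" "c + d > 0" "e + f > 0"
    and le: "a + b \<le> c + e + (d + f)"
  shows "(a = c \<and> b = d) \<or> (a = e \<and> b = f)"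
proof -
  \<comment> \<open>Cramer's rule for the coordinates: the determinant \<delta> is 1 or -1, hence
    its own inverse, and division becomes multiplication.\<close>
  define \<delta> where "\<delta> = c * f - d * e"
  define s where "s = \<delta> * (a * f - b * e)"
  define t where "t = \<delta> * (c * b - d * a)"
  have \<delta>: "\<delta> * \<delta> = 1" "\<delta> = 1 \<or> \<delta> = -1" using assms(1) unfolding \<delta>_def[symmetric] by (auto simp: abs_if split: if_splits)
  have "s * c + t * e = \<delta> * \<delta> * a" "s * d + t * f = \<delta> * \<delta> * b"
    unfolding s_def t_def \<delta>_def by algebra+
  then have ab: "a = s * c + t * e" "b = s * d + t * f" using \<delta> by simp_all
  have "s - t = \<delta> * (a * (d + f) - b * (c + e))"
    unfolding s_def t_def by (simp add: algebra_simps)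
  then have st: "s = t + 1 \<or> t = s + 1" using assms(2) \<delta>(2) by (auto simp: abs_if split: if_splits)
  \<comment> \<open>As \<open>s\<close> and \<open>t\<close> differ by 1, the size
    \<open>a + b\<close> is \<open>m * N\<close> plus the size of one parent. It exceeds
    \<open>N\<close> if \<open>m \<ge> 1\<close> and is negative if
    \<open>m \<le> -1\<close>.\<close>
  define m where "m = min s t"
  define N where "N = c + d + e + f"
  have sz: "a + b = s * (c + d) + t * (e + f)" using ab by (simp add: algebra_simps)
  have "m = 0"
  proof (rule ccontr)
    assume "m \<noteq> 0"
    then consider "m \<ge> 1" | "m \<le> -1" by linarith
    then show False
    proof cases
      case 1
      then have "N \<le> m * N" using assms(9,10) by (simp add: N_def)
      moreover have "a + b = m * N + (c + d) \<or> a + b = m * N + (e + f)"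
        using sz st by (auto simp: m_def N_def algebra_simps)
      ultimately show False using assms(9,10) le N_def by linarith
    next
      case 2
      have "m * N \<le> (-1) * N" using 2 assms(9,10) by (intro mult_right_mono) (auto simp: N_def)
      moreover have "a + b = m * N + (c + d) \<or> a + b = m * N + (e + f)"
        using sz st by (auto simp: m_def N_def algebra_simps)
      ultimately show False using assms(3,4,9,10) N_def by linarith
    qed
  qed
  then have "(s = 1 \<and> t = 0) \<or> (s = 0 \<and> t = 1)" using st by (auto simp: m_def)
  then show ?thesis using ab by auto
qed

lemma neighbour_is_parent:
  assumes "x > 0" "parents_pos x = (m, r)" "xnum u \<ge> 0" "xsize u \<le> xsize (Fin x)"
    and "\<bar>xnum u * xden (Fin x) - xden u * xnum (Fin x)\<bar> = 1"
  shows "u = m \<or> u = r"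
proof -
  note f = parents_pos_farey[OF assms(1,2)]
  have "xnum u + xden u \<le> xnum (Fin x) + xden (Fin x)"
    using assms(3,4) f xden_nonneg[of u] by (auto simp: xsize_def)
  then show ?thesis
    using farey_neighbour_is_parent[OF parents_pos_det[OF assms(1,2)] _ assms(3) xden_nonneg f(3-8)]
      assms(5) f(1,2) xrat_eqI by metis
qed

section \<open>The positive scheme\<close>

text \<open>The disjunction hides both the parity and which parent is smaller. The initial value at
  1 obeys the same rule, the parents of 1 being \<open>Inf\<close> and \<open>Fin 0\<close>.\<close>

lemma E_pos_parents:
  assumes "x > 0" "parents_pos x = (m, r)"
  shows "E_pos G A B (Fin x) = E_pos G A B m \<otimes>\<^bsub>G\<^esub> E_pos G A B r \<or>
    E_pos G A B (Fin x) = E_pos G A B r \<otimes>\<^bsub>G\<^esub> E_pos G A B m"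
proof (cases "x = 1")
  case True
  then have "m = Inf" "r = Fin 0" using assms(2) parents_pos_one by simp_all
  then show ?thesis using True by simp
next
  case False
  have "increasing_parents x = (m, r) \<or> increasing_parents x = (r, m)"
    using assms by (simp add: increasing_parents_def parents_def)
  then show ?thesis
    using assms(1) False by (subst (1 2) E_pos.simps) (auto simp del: E_pos.simps xnum.simps xden.simps)
qed

lemma E_pos_closed:
  assumes "group G" "A \<in> carrier G" "B \<in> carrier G" "xnum u \<ge> 0"
  shows "E_pos G A B u \<in> carrier G"
  using assms(4)
proof (induction "xsize u" arbitrary: u rule: less_induct)
  case less
  interpret group G by fact
  from less.prems show ?case
  proof (cases rule: xnum_nonneg_cases)
    case (3 x)
    obtain m r where mr: "parents_pos x = (m, r)" by force
    note f = parents_pos_farey[OF 3(2) mr]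
    have "xsize m < xsize u" "xsize r < xsize u"
      using xsize_parents_pos[OF 3(2)] mr 3(1) by auto
    then have "E_pos G A B m \<in> carrier G" "E_pos G A B r \<in> carrier G"
      using less.hyps f by auto
    then show ?thesis
      using E_pos_parents[OF 3(2) mr, of G A B] 3(1) by (auto simp del: E_pos.simps)
  qed (use assms in auto)
qed

lemma generate_E_pos:
  assumes "group G" "A \<in> carrier G" "B \<in> carrier G"
    and "xnum u \<ge> 0" "xnum v \<ge> 0" "\<bar>xnum u * xden v - xden u * xnum v\<bar> = 1"
  shows "generate G {E_pos G A B u, E_pos G A B v} = generate G {A, B}"
  using assms(4-6)
proof (induction "xsize u + xsize v" arbitrary: u v rule: less_induct)
  case less
  interpret group G by fact
  define g where "g = E_pos G A B"
  \<comment> \<open>The induction hypothesis enters as a premise, so that the step can be applied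
    with the two points in either order.\<close>
  have descend: "generate G {g u, g v} = generate G {A, B}"
    if nn: "xnum u \<ge> 0" and v: "v = Fin x" "x > 0" and det: "\<bar>xnum u * xden v - xden u * xnum v\<bar> = 1"
      and le: "xsize u \<le> xsize v"
      and IH: "\<And>w. xsize w < xsize v \<Longrightarrow> xnum w \<ge> 0 \<Longrightarrow>
        \<bar>xnum u * xden w - xden u * xnum w\<bar> = 1 \<Longrightarrow> generate G {g u, g w} = generate G {A, B}"
    for u v x
  proof -
    obtain m r where mr: "parents_pos x = (m, r)" by force
    note f = parents_pos_farey[OF v(2) mr]
    have sz: "xsize m < xsize v" "xsize r < xsize v"
      using xsize_parents_pos[OF v(2)] mr v(1) by auto
    have um: "u = m \<or> u = r"
      using neighbour_is_parent[OF v(2) mr nn] le det v(1) by simp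
    \<comment> \<open>The parent of \<open>x\<close> other than \<open>u\<close>. It is again a
      neighbour of \<open>u\<close>, since the two parents have determinant 1 or -1.\<close>
    define w where "w = (if u = m then r else m)"
    have w: "xsize w < xsize v" "xnum w \<ge> 0" "\<bar>xnum u * xden w - xden u * xnum w\<bar> = 1"
      using um sz f parents_pos_det[OF v(2) mr] by (auto simp: w_def algebra_simps abs_if split: if_splits)
    have "g v = g u \<otimes>\<^bsub>G\<^esub> g w \<or> g v = g w \<otimes>\<^bsub>G\<^esub> g u"
      using E_pos_parents[OF v(2) mr, of G A B] um v(1) by (auto simp: w_def g_def simp del: E_pos.simps)
    moreover have "g u \<in> carrier G" "g w \<in> carrier G"
      using E_pos_closed[OF assms(1-3)] nn w(2) by (simp_all add: g_def del: E_pos.simps)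
    ultimately have "generate G {g u, g v} = generate G {g u, g w}"
      using generate_pair_mult by blast
    then show ?thesis using IH[OF w] by simp
  qed
  \<comment> \<open>\<open>Inf\<close> and \<open>Fin 0\<close> have size 1, so a larger size forces
    a positive rational: unless both points are initial, one of maximal size has parents.\<close>
  have big: "xsize (Fin x) > 1" if "x > 0" for x
  proof -
    obtain m r where mr: "parents_pos x = (m, r)" by force
    show ?thesis using parents_pos_farey[OF that mr] unfolding xsize_def by linarith
  qed
  have IHu: "generate G {g u, g w} = generate G {A, B}"
    if "xsize w < xsize v" "xnum w \<ge> 0" "\<bar>xnum u * xden w - xden u * xnum w\<bar> = 1" for w
    using less.hyps[of u w] that less.prems by (simp add: g_def del: E_pos.simps)
  have IHv: "generate G {g v, g w} = generate G {A, B}"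
    if "xsize w < xsize u" "xnum w \<ge> 0" "\<bar>xnum v * xden w - xden v * xnum w\<bar> = 1" for w
    using less.hyps[of v w] that less.prems by (simp add: g_def del: E_pos.simps)
  have det': "\<bar>xnum v * xden u - xden v * xnum u\<bar> = 1"
    using less.prems(3) by (simp add: mult.commute abs_minus_commute)
  consider (v) x where "v = Fin x" "x > 0" "xsize u \<le> xsize v"
    | (u) x where "u = Fin x" "x > 0" "xsize v \<le> xsize u"
    | (base) "u \<in> {Inf, Fin 0}" "v \<in> {Inf, Fin 0}"
  proof -
    have ends: "w \<in> {Inf, Fin 0} \<and> xsize w = 1 \<or> (\<exists>x>0. w = Fin x)" if "xnum w \<ge> 0" for w
      using that by (cases rule: xnum_nonneg_cases) (auto simp: xsize_def)
    show thesis
      using ends[OF less.prems(1)] ends[OF less.prems(2)] that big linear[of "xsize u" "xsize v"]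
      by (metis not_le)
  qed
  then have "generate G {g u, g v} = generate G {A, B}"
  proof cases
    case v
    then show ?thesis using descend[of u v] IHu less.prems by blast
  next
    case u
    then have "generate G {g v, g u} = generate G {A, B}"
      using descend[of v u] IHv less.prems det' by blast
    then show ?thesis by (simp add: insert_commute)
  next
    case base
    \<comment> \<open>The determinant condition rules out \<open>u = v\<close>.\<close>
    then have "{g u, g v} = {inv\<^bsub>G\<^esub> A, B}" using less.prems(3) by (auto simp: g_def)
    then show ?thesis using generate_pair_inv assms(2,3) by simp
  qed
  then show ?case by (simp add: g_def del: E_pos.simps)
qed

section \<open>The negative scheme by reflection\<close>

text \<open>Negation reverses the order, and the negative scheme lists its parents in the reversed
  order; the positions in the pair therefore match.\<close>

lemma decreasing_parents_uminus:
  assumes "x > 0" "increasing_parents x = (m, r)"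
  shows "decreasing_parents (- x) = (xneg m, xneg r)"
  using assms less_neg_xneg(1)[of "- x"]
  by (auto simp: increasing_parents_def decreasing_parents_def parents_def split: prod.splits if_splits)

text \<open>The numerator rule is confined to finite points because \<open>xneg\<close> fixes
  \<open>Inf\<close>, whose numerator is 1.\<close>

lemma xnum_xneg: "xnum (xneg (Fin x)) = - xnum (Fin x)" "xden (xneg u) = xden u"
  by (simp add: quotient_of_uminus) (cases u; simp add: quotient_of_uminus)

text \<open>The schemes agree clause by clause: a double inverse returns \<open>A\<close> at 0, and
  negation preserves the parity that decides the order of the factors.\<close>

lemma E_neg_xneg:
  assumes "group G" "A \<in> carrier G" "xnum u \<ge> 0"
  shows "E_neg G A B (xneg u) = E_pos G (inv\<^bsub>G\<^esub> A) B u"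
  using assms(3)
proof (induction "xsize u" arbitrary: u rule: less_induct)
  case less
  interpret group G by fact
  from less.prems show ?case
  proof (cases rule: xnum_nonneg_cases)
    case (3 x)
    obtain m r where mr: "increasing_parents x = (m, r)" by force
    obtain m' r' where mr': "parents_pos x = (m', r')" by force
    have "(m, r) = (m', r') \<or> (m, r) = (r', m')"
      using mr mr' 3(2) by (auto simp: increasing_parents_def parents_def split: if_splits)
    then have "xnum m \<ge> 0" "xnum r \<ge> 0"
      using parents_pos_farey[OF 3(2) mr'] by auto
    moreover have "xsize m < xsize u" "xsize r < xsize u"
      using xsize_ordered_parents(1)[OF _ mr] 3 by auto
    ultimately have IH: "E_neg G A B (xneg m) = E_pos G (inv\<^bsub>G\<^esub> A) B m"
      "E_neg G A B (xneg r) = E_pos G (inv\<^bsub>G\<^esub> A) B r"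
      using less.hyps by auto
    have par: "odd (xnum (Fin (-x)) * xden (Fin (-x))) = odd (xnum (Fin x) * xden (Fin x))"
      using xnum_xneg(1)[of x] xnum_xneg(2)[of "Fin x"] by simp
    show ?thesis
    proof (cases "x = 1")
      case True
      then show ?thesis using 3 assms(2) by simp
    next
      case False
      have "E_neg G A B (Fin (- x)) =
         (if odd (xnum (Fin x) * xden (Fin x))
          then E_neg G A B (xneg r) \<otimes>\<^bsub>G\<^esub> E_neg G A B (xneg m)
          else E_neg G A B (xneg m) \<otimes>\<^bsub>G\<^esub> E_neg G A B (xneg r))"
        using 3(2) False unfolding E_neg.simps(2) par decreasing_parents_uminus[OF 3(2) mr]
        by (simp del: xnum.simps xden.simps)
      moreover have "E_pos G (inv\<^bsub>G\<^esub> A) B (Fin x) =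
         (if odd (xnum (Fin x) * xden (Fin x))
          then E_pos G (inv\<^bsub>G\<^esub> A) B r \<otimes>\<^bsub>G\<^esub> E_pos G (inv\<^bsub>G\<^esub> A) B m
          else E_pos G (inv\<^bsub>G\<^esub> A) B m \<otimes>\<^bsub>G\<^esub> E_pos G (inv\<^bsub>G\<^esub> A) B r)"
        using 3(2) False mr unfolding E_pos.simps(2)
        by (simp del: xnum.simps xden.simps)
      ultimately show ?thesis using 3(1) IH by simp
    qed
  qed (use assms in auto)
qed

lemma generate_E_neg:
  assumes "group G" "A \<in> carrier G" "B \<in> carrier G"
    and "xnum (xneg u) \<ge> 0" "xnum (xneg v) \<ge> 0" "\<bar>xnum u * xden v - xden u * xnum v\<bar> = 1"
  shows "generate G {E_neg G A B u, E_neg G A B v} = generate G {A, B}"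
proof -
  interpret group G by fact
  have nn: "xneg (xneg w) = w" for w by (cases w) auto
  \<comment> \<open>Between finite points the determinant changes sign; if one point is
    \<open>Inf\<close>, only a denominator survives and nothing changes.\<close>
  have "\<bar>xnum (xneg u) * xden (xneg v) - xden (xneg u) * xnum (xneg v)\<bar> = 1"
    using assms(6) by (cases u; cases v) (simp_all add: quotient_of_uminus abs_minus_commute)
  then have "generate G {E_pos G (inv\<^bsub>G\<^esub> A) B (xneg u), E_pos G (inv\<^bsub>G\<^esub> A) B (xneg v)}
      = generate G {inv\<^bsub>G\<^esub> A, B}"
    using generate_E_pos[OF assms(1) inv_closed[OF assms(2)] assms(3-5)] by blast
  then show ?thesis
    using E_neg_xneg[OF assms(1,2,4), of B] E_neg_xneg[OF assms(1,2,5), of B]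
      generate_pair_inv assms(2,3) nn by simp
qed

section \<open>Combining the two schemes\<close>

text \<open>For finite points of opposite strict signs the determinant is a sum of two nonzero
  integers of equal sign, so its absolute value is at least 2. \<open>Inf\<close> satisfies both
  alternatives.\<close>

lemma farey_neighbours_same_sign:
  assumes "\<bar>xnum u * xden v - xden u * xnum v\<bar> = 1"
  shows "(xnum u \<ge> 0 \<and> xnum v \<ge> 0) \<or> (xnum (xneg u) \<ge> 0 \<and> xnum (xneg v) \<ge> 0)"
proof (cases u; cases v)
  fix x y assume uv: "u = Fin x" "v = Fin y"
  have opp: False if "p < 0" "p' > 0" "q > 0" "q' > 0" "\<bar>p * q' - q * p'\<bar> = 1" for p q p' q' :: int
  proof -
    have "p * q' < 0" "q * p' > 0" using that by (simp_all add: mult_neg_pos)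
    then show False using that(5) by linarith
  qed
  have d: "xden u > 0" "xden v > 0" using uv by (auto simp: quotient_of_denom_pos')
  have assm': "\<bar>xnum v * xden u - xden v * xnum u\<bar> = 1"
    using assms by (simp add: mult.commute abs_minus_commute)
  have "\<not> (xnum u < 0 \<and> xnum v > 0)" "\<not> (xnum v < 0 \<and> xnum u > 0)"
    using opp[of "xnum u" "xnum v" "xden u" "xden v"] opp[of "xnum v" "xnum u" "xden v" "xden u"]
      d assms assm' by auto
  then show ?thesis unfolding uv xnum_xneg by linarith
qed (auto simp: quotient_of_uminus)

text \<open>The schemes overlap at 0 and \<open>Inf\<close>. They agree at \<open>Inf\<close>, while
  at 0 \<open>E\<close> takes the positive value, the inverse of the negative one.\<close>

lemma E_eq_E_neg:
  assumes "xnum (xneg u) \<ge> 0"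
  shows "E G A B u = (if u = Fin 0 then inv\<^bsub>G\<^esub> A else E_neg G A B u)"
proof (cases u)
  case (Fin x)
  then have "x \<le> 0" using assms xnum_Fin_nonneg_iff[of "- x"] by simp
  then show ?thesis using Fin by (auto simp: E_def simp del: E_neg.simps)
qed (simp add: E_def)

lemma E_eq_E_pos: "xnum u \<ge> 0 \<Longrightarrow> E G A B u = E_pos G A B u"
  by (erule xnum_nonneg_cases) (auto simp: E_def simp del: E_pos.simps E_neg.simps)

theorem theorem2p2:
  fixes F :: "('a, 'b) monoid_scheme" and A B :: 'a and u v :: xrat
  assumes "group F"
    and "A \<noteq> B"
    and "free_basis F {A, B}"
    and "\<bar>xnum u * xden v - xden u * xnum v\<bar> = 1"
  shows "generate F {E F A B u, E F A B v} = carrier F"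
proof -
  interpret group F by fact
  have AB: "A \<in> carrier F" "B \<in> carrier F" using assms(3) by (auto simp: free_basis_def)
  have "generate F {E F A B u, E F A B v} = generate F {A, B}"
    using farey_neighbours_same_sign[OF assms(4)]
  proof
    assume "xnum u \<ge> 0 \<and> xnum v \<ge> 0"
    then show ?thesis
      using generate_E_pos[OF assms(1) AB _ _ assms(4)] by (simp add: E_eq_E_pos)
  next
    assume nn: "xnum (xneg u) \<ge> 0 \<and> xnum (xneg v) \<ge> 0"
    have closed: "E_neg F A B w \<in> carrier F" if "xnum (xneg w) \<ge> 0" for w
    proof -
      have "xneg (xneg w) = w" by (cases w) auto
      then show ?thesis
        using E_neg_xneg[OF assms(1) AB(1) that, of B] E_pos_closed[OF assms(1) _ AB(2) that] AB by simp
    qed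
    have gen: "generate F {E_neg F A B u, E_neg F A B v} = generate F {A, B}"
      using generate_E_neg[OF assms(1) AB _ _ assms(4)] nn by simp
    have zero: "E_neg F A B (Fin 0) = A" by simp
    \<comment> \<open>At most one of the two words is thus inverted relative to the negative scheme,
      and \<open>generate_pair_inv\<close> absorbs that inversion.\<close>
    have "u \<noteq> Fin 0 \<or> v \<noteq> Fin 0" using assms(4) by auto
    then consider "u \<noteq> Fin 0" "v \<noteq> Fin 0" | "u = Fin 0" "v \<noteq> Fin 0" | "u \<noteq> Fin 0" "v = Fin 0"
      by blast
    then show ?thesis
    proof cases
      case 1
      then show ?thesis using gen nn by (simp add: E_eq_E_neg)
    next
      case 2
      then show ?thesis
        using gen nn generate_pair_inv[OF AB(1) closed[of v]] zero by (simp add: E_eq_E_neg)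
    next
      case 3
      then show ?thesis
        using gen nn generate_pair_inv[OF AB(1) closed[of u]] zero
        by (simp add: E_eq_E_neg insert_commute)
    qed
  qed
  then show ?thesis using generate_free_basis[OF assms(3)] by simp
qed

end
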